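(* Let $k,\ell \geq 0$ be integers. If a rooted graph $(G,i)$ allows the nullity pair $(k+1,\ell+1)$, then it allows the nullity pair $(k,\ell)$.
   Context: All graphs are finite and simple. For a graph $G$ on $n$ vertices labeled $1,\dots,n$, $\mathcal{S}(G)$ is the set of $n\times n$ real symmetric matrices whose off-diagonal $(j,k)$-entry is nonzero iff $\{j,k\}\in E(G)$ (diagonal arbitrary). $A(i)$ is $A$ with row and column $i$ deleted. The $i$-nullity pair of $A$ is $(\operatorname{null}(A),\operatorname{null}(A(i)))$. A rooted graph $(G,i)$ is a graph with a designated root vertex $i$; it allows the nullity pair $(k,\ell)$ if some $A\in\mathcal{S}(G)$ has $i$-nullity pair $(k,\ell)$. *)

theory Defs
  imports "Jordan_Normal_Form.Matrix_Kernel"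
begin

text \<open>Vertices are labelled \<open>0, \<dots>, n - 1\<close>, matching the 0-based indexing of matrices; a graph on
  these \<open>n\<close> vertices is given by its set of edges, each a 2-element set of vertices.\<close>

definition simple_graph :: "nat \<Rightarrow> nat set set \<Rightarrow> bool" where
  "simple_graph n E \<longleftrightarrow> (\<forall>e\<in>E. e \<subseteq> {..<n} \<and> card e = 2)"

definition rooted_graph :: "nat \<Rightarrow> nat set set \<Rightarrow> nat \<Rightarrow> bool" where
  "rooted_graph n E i \<longleftrightarrow> simple_graph n E \<and> i < n"

definition sym_matrices :: "nat \<Rightarrow> nat set set \<Rightarrow> real mat set" where
  "sym_matrices n E = {A \<in> carrier_mat n n. transpose_mat A = A \<and>
     (\<forall>j<n. \<forall>k<n. j \<noteq> k \<longrightarrow> (A $$ (j, k) \<noteq> 0 \<longleftrightarrow> {j, k} \<in> E))}"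

definition nullity_pair :: "nat \<Rightarrow> real mat \<Rightarrow> nat \<times> nat" where
  "nullity_pair i A = (kernel_dim A, kernel_dim (mat_delete A i i))"

definition allows_nullity_pair :: "nat \<Rightarrow> nat set set \<Rightarrow> nat \<Rightarrow> nat \<times> nat \<Rightarrow> bool" where
  "allows_nullity_pair n E i p \<longleftrightarrow> (\<exists>A \<in> sym_matrices n E. nullity_pair i A = p)"

end

theory Submission
  imports Defs
begin

text \<open>If a symmetric \<open>A\<close> has a kernel vector that is nonzero at \<open>j\<close>, then changing the diagonal
  entry \<open>(j, j)\<close> cuts the kernel down to its hyperplane \<open>v\<^sub>j = 0\<close>, so the nullity drops by exactly
  one. It remains to find a \<open>j \<noteq> i\<close> that works for \<open>A\<close> and \<open>A(i)\<close> at once, and any nonzero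
  \<open>z \<in> ker A\<close> with \<open>z\<^sub>i = 0\<close> provides one. Such a \<open>z\<close> exists: if some \<open>x \<in> ker A\<close> has
  \<open>x\<^sub>i \<noteq> 0\<close>, extend a nonzero vector of \<open>ker A(i)\<close> by \<open>z\<^sub>i = 0\<close>; then \<open>A z\<close> is a multiple
  of the unit vector \<open>e\<^sub>i\<close> and orthogonal to \<open>x\<close>, hence zero.\<close>

text \<open>A basis of \<open>mat_kernel B\<close> becomes a basis of \<open>mat_kernel A\<close>
  once \<open>x\<close> is added: \<open>x\<close> lies outside the span because
  \<open>x $ j\<close> is nonzero, and every vector of \<open>mat_kernel A\<close> lands in the
  hyperplane after subtraction of a suitable multiple of \<open>x\<close>.\<close>

lemma kernel_dim_hyperplane:
  fixes A B :: "'a :: field mat"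
  assumes A: "A \<in> carrier_mat m n" and B: "B \<in> carrier_mat m' n" and j: "j < n"
    and ker: "mat_kernel B = {v \<in> mat_kernel A. v $ j = 0}"
    and x: "x \<in> mat_kernel A" and xj: "x $ j \<noteq> 0"
  shows "kernel_dim A = Suc (kernel_dim B)"
proof -
  interpret KA: kernel m n A by (unfold_locales, rule A)
  interpret KB: kernel m' n B by (unfold_locales, rule B)
  obtain S where fin: "finite S" and S: "KB.basis S"
    using kernel_basis_exists[OF B] by blast
  have SB: "S \<subseteq> mat_kernel B" and liB: "KB.lin_indpt S" and spB: "KB.span S = mat_kernel B"
    using S unfolding KB.Ker.basis_def by auto
  have SA: "S \<subseteq> mat_kernel A" using SB ker by auto
  \<comment> \<open>Spans and linear dependence in either kernel are those of the ambient vector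
    space, so both facts about \<open>S\<close> carry over from \<open>B\<close> to
    \<open>A\<close>.\<close>
  have spA: "KA.span S = mat_kernel B"
    using KA.span_same[OF SA] KB.span_same[OF SB] spB by simp
  have liA: "KA.lin_indpt S"
    using KA.lindep_same[OF SA] KB.lindep_same[OF SB] liB by simp
  have xB: "x \<notin> KA.span S" using spA ker xj by auto
  have xS: "x \<notin> S" using SB ker xj by auto
  have TA: "insert x S \<subseteq> mat_kernel A" using SA x by auto
  have li: "KA.lin_indpt (insert x S)"
    using KA.Ker.lin_dep_iff_in_span[OF SA liA x xS] xB by simp
  have "mat_kernel A \<subseteq> KA.span (insert x S)"
  proof
    fix v assume v: "v \<in> mat_kernel A"
    \<comment> \<open>This multiple of \<open>x\<close> cancels the entry of \<open>v\<close> at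
      \<open>j\<close>.\<close>
    define c where "c = v $ j / x $ j"
    define w where "w = v + (- c) \<cdot>\<^sub>v x"
    have vc: "v \<in> carrier_vec n" and xc: "x \<in> carrier_vec n"
      using v x mat_kernelD(1)[OF A] by auto
    have wA: "w \<in> mat_kernel A"
      unfolding w_def using KA.Ker.a_closed[OF v] mat_kernel_smult[OF A x] by simp
    moreover have "w $ j = 0"
      using vc xc j xj by (simp add: w_def c_def)
    ultimately have "w \<in> KA.span S" using spA ker by auto
    then have w: "w \<in> KA.span (insert x S)"
      using KA.Ker.span_is_monotone[of S "insert x S"] by auto
    have "x \<in> KA.span (insert x S)" using KA.Ker.span_mem[OF TA] by auto
    moreover have sub: "submodule class_ring (KA.span (insert x S)) KA.VK"
      using KA.Ker.span_is_submodule[OF TA] .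
    ultimately have "c \<cdot>\<^sub>v x \<in> KA.span (insert x S)"
      using submodule.smult_closed[OF sub, of c x] by (simp add: class_ring_simps)
    then have "w + c \<cdot>\<^sub>v x \<in> KA.span (insert x S)"
      using submodule.m_closed[OF sub] w by fastforce
    also have "w + c \<cdot>\<^sub>v x = v"
      using vc xc by (intro eq_vecI) (auto simp: w_def)
    finally show "v \<in> KA.span (insert x S)" .
  qed
  then have "KA.basis (insert x S)"
    using li TA KA.Ker.span_is_subset2[OF TA] unfolding KA.Ker.basis_def by auto
  then have "kernel_dim A = card (insert x S)"
    using KA.Ker.dim_basis fin by simp
  also have "\<dots> = Suc (kernel_dim B)"
    using KB.Ker.dim_basis[OF fin S] xS fin by simp
  finally show ?thesis .
qed

lemma kernel_dim_pos_obtains: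
  fixes A :: "'a :: field mat"
  assumes A: "A \<in> carrier_mat m n" and pos: "kernel_dim A > 0"
  obtains v where "v \<in> mat_kernel A" "v \<noteq> 0\<^sub>v n"
proof -
  interpret KA: kernel m n A by (unfold_locales, rule A)
  obtain S where fin: "finite S" and S: "KA.basis S"
    using kernel_basis_exists[OF A] by blast
  have "card S > 0" using pos KA.Ker.dim_basis[OF fin S] by simp
  then obtain v where v: "v \<in> S" by fastforce
  have "S \<subseteq> mat_kernel A" and li: "KA.lin_indpt S"
    using S unfolding KA.Ker.basis_def by auto
  with v have "v \<in> mat_kernel A" "v \<noteq> 0\<^sub>v n"
    using KA.Ker.vs_zero_lin_dep by auto
  then show thesis by (rule that)
qed

text \<open>Here \<open>B v\<close> is \<open>A v\<close> plus \<open>t * v $ j\<close> times the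
  unit vector at \<open>j\<close>. By symmetry \<open>x\<close> is orthogonal to the range of
  \<open>A\<close>, so pairing \<open>B v = 0\<close> with \<open>x\<close> leaves
  \<open>t * v $ j * x $ j = 0\<close>; hence \<open>v $ j = 0\<close>, and then
  \<open>A v = 0\<close>. Since \<open>B\<close> is given entrywise, the lemma also applies to a
  matrix obtained by deleting a row and column.\<close>

lemma kernel_dim_diag_perturb:
  fixes A B :: "'a :: field mat"
  assumes A: "A \<in> carrier_mat n n" and sym: "transpose_mat A = A"
    and B: "B \<in> carrier_mat n n" and j: "j < n" and t: "t \<noteq> 0"
    and BA: "\<And>r c. r < n \<Longrightarrow> c < n \<Longrightarrow> B $$ (r, c) = A $$ (r, c) + (if r = j \<and> c = j then t else 0)"
    and x: "x \<in> mat_kernel A" and xj: "x $ j \<noteq> 0"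
  shows "kernel_dim A = Suc (kernel_dim B)"
proof (rule kernel_dim_hyperplane[OF A B j _ x xj])
  have xc: "x \<in> carrier_vec n" and Ax: "A *\<^sub>v x = 0\<^sub>v n" using mat_kernelD[OF A x] by auto
  have Bv: "B *\<^sub>v v = A *\<^sub>v v + (t * v $ j) \<cdot>\<^sub>v unit_vec n j" if v: "v \<in> carrier_vec n" for v
  proof (rule eq_vecI)
    fix r assume "r < dim_vec (A *\<^sub>v v + (t * v $ j) \<cdot>\<^sub>v unit_vec n j)"
    then have r: "r < n" by simp
    have "(B *\<^sub>v v) $ r = (\<Sum>c<n. B $$ (r, c) * v $ c)"
      using B v r by (auto simp: scalar_prod_def lessThan_atLeast0 intro!: sum.cong)
    also have "\<dots> = (\<Sum>c<n. A $$ (r, c) * v $ c) + (\<Sum>c<n. if c = j then (if r = j then t * v $ c else 0) else 0)"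
      unfolding sum.distrib[symmetric] by (rule sum.cong) (auto simp: BA r algebra_simps)
    also have "\<dots> = (A *\<^sub>v v + (t * v $ j) \<cdot>\<^sub>v unit_vec n j) $ r"
      using A v r j by (auto simp: scalar_prod_def lessThan_atLeast0 intro!: sum.cong)
    finally show "(B *\<^sub>v v) $ r = (A *\<^sub>v v + (t * v $ j) \<cdot>\<^sub>v unit_vec n j) $ r" .
  qed (use A B in auto)
  have 0: "(0 :: 'a) \<cdot>\<^sub>v unit_vec n j = 0\<^sub>v n" by (intro eq_vecI) auto
  have eq: "B *\<^sub>v v = 0\<^sub>v n \<longleftrightarrow> A *\<^sub>v v = 0\<^sub>v n \<and> v $ j = 0" if v: "v \<in> carrier_vec n" for v
  proof
    assume Bv0: "B *\<^sub>v v = 0\<^sub>v n"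
    have "x \<bullet> (A *\<^sub>v v) = (A *\<^sub>v x) \<bullet> v"
      using transpose_vec_mult_scalar[OF A v xc] sym by simp
    then have "x \<bullet> (B *\<^sub>v v) = t * v $ j * x $ j"
      unfolding Bv[OF v] using A xc v j
      by (simp add: scalar_prod_add_distrib[of _ n] Ax scalar_prod_right_unit)
    with Bv0 t xj xc have vj: "v $ j = 0" by simp
    with Bv0 show "A *\<^sub>v v = 0\<^sub>v n \<and> v $ j = 0"
      unfolding Bv[OF v] using A v by (simp add: 0)
  qed (use A v in \<open>auto simp: Bv 0\<close>)
  show "mat_kernel B = {v \<in> mat_kernel A. v $ j = 0}"
    unfolding mat_kernel[OF A] mat_kernel[OF B] using eq by auto
qed

text \<open>\<open>insert_index i\<close> enumerates the indices other than \<open>i\<close>, and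
  the omitted column contributes nothing because \<open>v $ i = 0\<close>. This serves both to
  extend kernel vectors of \<open>A(i)\<close> by zero and to restrict those of
  \<open>A\<close>.\<close>

lemma mat_delete_mult_vec_index:
  fixes A :: "'a :: comm_ring_1 mat"
  assumes A: "A \<in> carrier_mat (Suc m) (Suc m)" and i: "i < Suc m"
    and v: "v \<in> carrier_vec (Suc m)" and vi: "v $ i = 0" and r: "r < m"
  shows "(mat_delete A i i *\<^sub>v vec m (\<lambda>c. v $ insert_index i c)) $ r = (A *\<^sub>v v) $ insert_index i r"
proof -
  have ir: "insert_index i r < Suc m" using r by (simp add: insert_index_def)
  have A': "mat_delete A i i \<in> carrier_mat m m" using mat_delete_carrier[OF A] by simp
  let ?f = "\<lambda>c. A $$ (insert_index i r, c) * v $ c"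
  have "(mat_delete A i i *\<^sub>v vec m (\<lambda>c. v $ insert_index i c)) $ r
      = (\<Sum>c\<in>{0..<m}. ?f (insert_index i c))"
    using A A' r by (auto simp: scalar_prod_def mat_delete_index[OF A i i] intro!: sum.cong)
  also have "\<dots> = sum ?f (insert_index i ` {0..<m})"
    by (subst sum.reindex) (auto simp: insert_index_inj_on)
  also have "\<dots> = sum ?f {0..<Suc m}"
    unfolding insert_index_image[OF i] using vi by (intro sum.mono_neutral_left) auto
  also have "\<dots> = (A *\<^sub>v v) $ insert_index i r"
    using A v ir by (auto simp: scalar_prod_def intro!: sum.cong)
  finally show ?thesis .
qed

lemma kernel_vec_zero_at_root:
  fixes A :: "'a :: field mat"
  assumes A: "A \<in> carrier_mat (Suc m) (Suc m)" and sym: "transpose_mat A = A" and i: "i < Suc m"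
    and posA: "kernel_dim A > 0" and posD: "kernel_dim (mat_delete A i i) > 0"
  obtains z where "z \<in> mat_kernel A" "z \<noteq> 0\<^sub>v (Suc m)" "z $ i = 0"
proof -
  have D: "mat_delete A i i \<in> carrier_mat m m" using mat_delete_carrier[OF A] by simp
  obtain x where x: "x \<in> mat_kernel A" and x0: "x \<noteq> 0\<^sub>v (Suc m)"
    using kernel_dim_pos_obtains[OF A posA] .
  obtain y where y: "y \<in> mat_kernel (mat_delete A i i)" and y0: "y \<noteq> 0\<^sub>v m"
    using kernel_dim_pos_obtains[OF D posD] .
  have xc: "x \<in> carrier_vec (Suc m)" and Ax: "A *\<^sub>v x = 0\<^sub>v (Suc m)" using mat_kernelD[OF A x] .
  have yc: "y \<in> carrier_vec m" and Dy: "mat_delete A i i *\<^sub>v y = 0\<^sub>v m" using mat_kernelD[OF D y] .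
  show thesis
  proof (cases "x $ i = 0")
    case True
    with x x0 show thesis by (rule that)
  next
    case False
    \<comment> \<open>\<open>z\<close> is \<open>y\<close> with a zero inserted at position
      \<open>i\<close>.\<close>
    define z where "z = vec (Suc m) (\<lambda>r. if r = i then 0 else y $ delete_index i r)"
    have zc: "z \<in> carrier_vec (Suc m)" and zi: "z $ i = 0" using i by (auto simp: z_def)
    have zins: "z $ insert_index i r = y $ r" if "r < m" for r
      using that by (simp add: z_def insert_index_def delete_index_def)
    have zy: "vec m (\<lambda>c. z $ insert_index i c) = y" using yc zins by (intro eq_vecI) auto
    \<comment> \<open>Away from the root, the entries of \<open>A z\<close> are those of
      \<open>A(i) y\<close>, which vanish. Only entry \<open>i\<close> is left, and pairing with
      \<open>x\<close> will settle it.\<close>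
    have Az0: "(A *\<^sub>v z) $ s = 0" if s: "s < Suc m" "s \<noteq> i" for s
    proof -
      have "s \<in> insert_index i ` {0..<m}" unfolding insert_index_image[OF i] using s by auto
      then obtain r where r: "r < m" "s = insert_index i r" by auto
      then show ?thesis
        using mat_delete_mult_vec_index[OF A i zc zi r(1)] Dy unfolding zy by simp
    qed
    have "A *\<^sub>v z = (A *\<^sub>v z) $ i \<cdot>\<^sub>v unit_vec (Suc m) i"
      using A i Az0 by (intro eq_vecI) (auto simp del: index_mult_mat_vec)
    then have "x \<bullet> (A *\<^sub>v z) = x \<bullet> ((A *\<^sub>v z) $ i \<cdot>\<^sub>v unit_vec (Suc m) i)" by (rule arg_cong)
    also have "\<dots> = (A *\<^sub>v z) $ i * x $ i"
      using xc i by (simp del: index_mult_mat_vec)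
    finally have "x \<bullet> (A *\<^sub>v z) = (A *\<^sub>v z) $ i * x $ i" .
    moreover have "x \<bullet> (A *\<^sub>v z) = 0"
      using transpose_vec_mult_scalar[OF A zc xc] sym Ax zc by simp
    ultimately have "(A *\<^sub>v z) $ i = 0" using False by simp
    with Az0 have "(A *\<^sub>v z) $ s = 0" if "s < Suc m" for s using that by blast
    then have "A *\<^sub>v z = 0\<^sub>v (Suc m)"
      using A by (intro eq_vecI) (auto simp del: index_mult_mat_vec)
    then have "z \<in> mat_kernel A" by (rule mat_kernelI[OF A zc])
    moreover have "z \<noteq> 0\<^sub>v (Suc m)"
    proof
      assume z0: "z = 0\<^sub>v (Suc m)"
      have "y $ r = 0" if "r < m" for r
        using zins[OF that] that by (simp add: z0 insert_index_def split: if_splits)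
      with yc have "y = 0\<^sub>v m" by (intro eq_vecI) auto
      with y0 show False ..
    qed
    ultimately show thesis using zi by (rule that)
  qed
qed

theorem theorem3p1:
  fixes n i k l :: nat and E :: "nat set set"
  assumes "rooted_graph n E i"
    and "allows_nullity_pair n E i (k + 1, l + 1)"
  shows "allows_nullity_pair n E i (k, l)"
proof -
  obtain m where n: "n = Suc m" and i: "i < Suc m"
    using assms(1) unfolding rooted_graph_def by (cases n) auto
  obtain A where AS: "A \<in> sym_matrices n E"
    and nullA: "kernel_dim A = Suc k" and nullD: "kernel_dim (mat_delete A i i) = Suc l"
    using assms(2) unfolding allows_nullity_pair_def nullity_pair_def by auto
  then have A: "A \<in> carrier_mat (Suc m) (Suc m)" and sym: "transpose_mat A = A"
    unfolding sym_matrices_def n by auto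
  have D: "mat_delete A i i \<in> carrier_mat m m" using mat_delete_carrier[OF A] by simp
  have symA: "A $$ (r, c) = A $$ (c, r)" if "r < Suc m" "c < Suc m" for r c
    using that A sym by (metis carrier_matD index_transpose_mat(1))
  have symD: "transpose_mat (mat_delete A i i) = mat_delete A i i"
    using A i by (intro eq_matI) (auto simp: mat_delete_def intro!: symA)
  obtain z where z: "z \<in> mat_kernel A" and z0: "z \<noteq> 0\<^sub>v (Suc m)" and zi: "z $ i = 0"
    using kernel_vec_zero_at_root[OF A sym i] nullA nullD by auto
  have zc: "z \<in> carrier_vec (Suc m)" and Az: "A *\<^sub>v z = 0\<^sub>v (Suc m)" using mat_kernelD[OF A z] .
  obtain j where j: "j < Suc m" and zj: "z $ j \<noteq> 0"
    using z0 zc by (metis carrier_vecD eq_vecI index_zero_vec)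
  \<comment> \<open>\<open>j\<close> differs from \<open>i\<close> because \<open>z\<close> vanishes
    at \<open>i\<close>, so it survives the deletion, with new index \<open>j'\<close>.\<close>
  have "j \<in> insert_index i ` {0..<m}"
    unfolding insert_index_image[OF i] using j zj zi by auto
  then obtain j' where j': "j' < m" and jj': "j = insert_index i j'" by auto
  \<comment> \<open>Dropping the zero entry of \<open>z\<close> at the root gives a kernel vector of
    \<open>A(i)\<close> that is nonzero at \<open>j'\<close>: one diagonal position serves both
    matrices.\<close>
  define y where "y = vec m (\<lambda>c. z $ insert_index i c)"
  have "mat_delete A i i *\<^sub>v y = 0\<^sub>v m"
  proof (rule eq_vecI)
    fix r assume "r < dim_vec (0\<^sub>v m :: real vec)"
    then have r: "r < m" by simp
    then show "(mat_delete A i i *\<^sub>v y) $ r = 0\<^sub>v m $ r"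
      unfolding y_def mat_delete_mult_vec_index[OF A i zc zi r] Az
      by (simp add: insert_index_def)
  qed (use D in auto)
  then have y: "y \<in> mat_kernel (mat_delete A i i)"
    by (intro mat_kernelI[OF D]) (auto simp: y_def)
  have yj: "y $ j' \<noteq> 0" using zj j' by (simp add: y_def jj')
  \<comment> \<open>Any nonzero increment would do in place of 1. Only a diagonal entry changes, so
    the graph of the matrix stays the same.\<close>
  define B where "B = mat (Suc m) (Suc m) (\<lambda>(r, c). A $$ (r, c) + (if r = j \<and> c = j then 1 else 0))"
  have B: "B \<in> carrier_mat (Suc m) (Suc m)" unfolding B_def by auto
  have D': "mat_delete B i i \<in> carrier_mat m m" using mat_delete_carrier[OF B] by simp
  have "kernel_dim A = Suc (kernel_dim B)"
    by (rule kernel_dim_diag_perturb[OF A sym B j _ _ z zj, where t = 1]) (auto simp: B_def)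
  moreover have "kernel_dim (mat_delete A i i) = Suc (kernel_dim (mat_delete B i i))"
  \<comment> \<open>Perturbation and deletion commute: as \<open>insert_index i\<close> is
    injective, the changed entry \<open>(j, j)\<close> of \<open>B\<close> appears in
    \<open>B(i)\<close> exactly at \<open>(j', j')\<close>.\<close>
  proof (rule kernel_dim_diag_perturb[OF D symD D' j' _ _ y yj, where t = 1])
    fix r c assume rc: "r < m" "c < m"
    then have "insert_index i r < Suc m" "insert_index i c < Suc m"
      by (auto simp: insert_index_def)
    moreover have "insert_index i s = j \<longleftrightarrow> s = j'" for s
      unfolding jj' by (metis delete_insert_index)
    ultimately show "mat_delete B i i $$ (r, c)
        = mat_delete A i i $$ (r, c) + (if r = j' \<and> c = j' then 1 else 0)"
      unfolding mat_delete_index[OF A i i rc, symmetric] mat_delete_index[OF B i i rc, symmetric]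
      by (simp add: B_def)
  qed simp
  moreover have "B \<in> sym_matrices n E"
  proof -
    have "transpose_mat B = B" by (intro eq_matI) (auto simp: B_def intro: symA)
    moreover have "B $$ (r, c) = A $$ (r, c)" if "r < Suc m" "c < Suc m" "r \<noteq> c" for r c
      using that by (auto simp: B_def)
    ultimately show ?thesis using AS B unfolding sym_matrices_def n by auto
  qed
  ultimately show ?thesis
    using nullA nullD unfolding allows_nullity_pair_def nullity_pair_def by auto
qed

end
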